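(* Let $G$ be a topological group which is not extremely amenable, and let $(G,\mathrm{M}(G))$ be its universal minimal flow. Then $(G,\mathrm{M}(G))$ is effective at every $t\in G$ such that the subgroup $\langle\mathrm{Aut}(G)t\rangle$ is dense in $G$; that is, for every such $t$ there is some $x\in \mathrm{M}(G)$ with $tx\neq x$.
   Context: A topological group is a group with a Hausdorff topology such that $(x,y)\mapsto xy^{-1}$ is continuous. A flow $(G,X)$ consists of a topological group $G$ and a (nonempty) compact Hausdorff space $X$ with a jointly continuous action $G\times X\to X$, $(t,x)\mapsto tx$ (so $s(tx)=(st)x$ and $ex=x$). A flow is minimal if every orbit $Gx$ is dense in $X$. The universal minimal flow $(G,\mathrm{M}(G))$ is the minimal flow, unique up to isomorphism, such that for every minimal flow $(G,Y)$ there is a continuous surjective $G$-equivariant map $\mathrm{M}(G)\to Y$ (its existence and uniqueness are known). $G$ is extremely amenable if $\mathrm{M}(G)$ is a single point. $\mathrm{Aut}(G)$ is the group of topological automorphisms of $G$ (group automorphisms that are homeomorphisms), $\mathrm{Aut}(G)t=\{a(t)\mid a\in\mathrm{Aut}(G)\}$, and $\langle \mathrm{Aut}(G)t\rangle$ is the subgroup algebraically generated by $\mathrm{Aut}(G)t$. *)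

theory Defs
  imports "HOL-Analysis.Analysis" "HOL-Algebra.Group_Action" "HOL-Algebra.Generated_Groups"
begin

text \<open>Frees \<open>closure_of\<close> for the topological closure operator.\<close>
no_notation eq_closure_of ("closure'_of\<index>")

definition topological_group :: "('g, 'b) monoid_scheme \<Rightarrow> 'g topology \<Rightarrow> bool" where
  "topological_group G T \<longleftrightarrow>
     group G \<and> topspace T = carrier G \<and> Hausdorff_space T \<and>
     continuous_map (prod_topology T T) T (\<lambda>(x, y). x \<otimes>\<^bsub>G\<^esub> inv\<^bsub>G\<^esub> y)"

definition topological_auto :: "('g, 'b) monoid_scheme \<Rightarrow> 'g topology \<Rightarrow> ('g \<Rightarrow> 'g) set" where
  "topological_auto G T = {a \<in> auto G. homeomorphic_map T T a}"

definition flow ::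
  "('g, 'b) monoid_scheme \<Rightarrow> 'g topology \<Rightarrow> 'x topology \<Rightarrow> ('g \<Rightarrow> 'x \<Rightarrow> 'x) \<Rightarrow> bool" where
  "flow G T X \<phi> \<longleftrightarrow>
     topological_group G T \<and>
     topspace X \<noteq> {} \<and> compact_space X \<and> Hausdorff_space X \<and>
     group_action G (topspace X) \<phi> \<and>
     continuous_map (prod_topology T X) X (\<lambda>(t, x). \<phi> t x)"

definition minimal_flow ::
  "('g, 'b) monoid_scheme \<Rightarrow> 'g topology \<Rightarrow> 'x topology \<Rightarrow> ('g \<Rightarrow> 'x \<Rightarrow> 'x) \<Rightarrow> bool" where
  "minimal_flow G T X \<phi> \<longleftrightarrow>
     flow G T X \<phi> \<and> (\<forall>x \<in> topspace X. X closure_of (orbit G \<phi> x) = topspace X)"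

definition flow_map ::
  "('g, 'b) monoid_scheme \<Rightarrow> 'x topology \<Rightarrow> ('g \<Rightarrow> 'x \<Rightarrow> 'x) \<Rightarrow>
     'y topology \<Rightarrow> ('g \<Rightarrow> 'y \<Rightarrow> 'y) \<Rightarrow> ('x \<Rightarrow> 'y) \<Rightarrow> bool" where
  "flow_map G X \<phi> Y \<psi> h \<longleftrightarrow>
     continuous_map X Y h \<and>
     (\<forall>t \<in> carrier G. \<forall>x \<in> topspace X. h (\<phi> t x) = \<psi> t (h x))"

text \<open>
  The universal property quantifies over all minimal flows, and HOL cannot quantify over types
  inside a definition. It suffices to let the flows range over carriers inside the type
  \<^typ>\<open>'g set set\<close>: a minimal flow has a dense orbit, hence injects into the sets of subsets
  of \<open>G\<close>. The theorems \<open>minimal_flow_iso_set_set\<close> and \<open>universal_minimal_flow_surj\<close> below show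
  that nothing is lost: the surjection exists onto every minimal flow, on any type.
\<close>

definition universal_minimal_flow ::
  "('g, 'b) monoid_scheme \<Rightarrow> 'g topology \<Rightarrow> 'm topology \<Rightarrow> ('g \<Rightarrow> 'm \<Rightarrow> 'm) \<Rightarrow> bool" where
  "universal_minimal_flow G T M \<phi> \<longleftrightarrow>
     minimal_flow G T M \<phi> \<and>
     (\<forall>(Y :: 'g set set topology) \<psi>. minimal_flow G T Y \<psi> \<longrightarrow>
        (\<exists>h. flow_map G M \<phi> Y \<psi> h \<and> h ` topspace M = topspace Y))"

text \<open>
  Universal minimal flows are unique up to isomorphism, and by \<open>minimal_flow_iso_set_set\<close> each
  one has an isomorphic copy inside \<^typ>\<open>'g set set\<close>, so fixing that type is harmless here too.
\<close>

definition extremely_amenable :: "('g, 'b) monoid_scheme \<Rightarrow> 'g topology \<Rightarrow> bool" where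
  "extremely_amenable G T \<longleftrightarrow>
     (\<exists>(M :: 'g set set topology) \<phi> p. universal_minimal_flow G T M \<phi> \<and> topspace M = {p})"

definition effective_at :: "'x topology \<Rightarrow> ('g \<Rightarrow> 'x \<Rightarrow> 'x) \<Rightarrow> 'g \<Rightarrow> bool" where
  "effective_at X \<phi> t \<longleftrightarrow> (\<exists>x \<in> topspace X. \<phi> t x \<noteq> x)"

lemma group_action_alt:
  assumes "group G"
  shows "group_action G E \<phi> \<longleftrightarrow>
    (\<forall>g \<in> carrier G. \<phi> g \<in> extensional E \<and> (\<forall>x \<in> E. \<phi> g x \<in> E)) \<and>
    (\<forall>x \<in> E. \<phi> \<one>\<^bsub>G\<^esub> x = x) \<and>
    (\<forall>g \<in> carrier G. \<forall>h \<in> carrier G. \<forall>x \<in> E. \<phi> (g \<otimes>\<^bsub>G\<^esub> h) x = \<phi> g (\<phi> h x))"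
    (is "_ \<longleftrightarrow> ?R")
proof
  assume "group_action G E \<phi>"
  then interpret group_action G E \<phi> .
  show ?R
  proof (intro conjI ballI)
    fix g assume g: "g \<in> carrier G"
    show "\<phi> g \<in> extensional E" using bij_prop0[OF g] by (simp add: Bij_def)
    fix x assume "x \<in> E"
    then show "\<phi> g x \<in> E" using element_image g by blast
  next
    fix x assume "x \<in> E"
    then show "\<phi> \<one>\<^bsub>G\<^esub> x = x" using id_eq_one by (metis restrict_apply')
  next
    fix g h x assume "g \<in> carrier G" "h \<in> carrier G" "x \<in> E"
    then show "\<phi> (g \<otimes>\<^bsub>G\<^esub> h) x = \<phi> g (\<phi> h x)"
      using composition_rule by blast
  qed
next
  assume R: ?R
  interpret group G by fact
  have B: "\<phi> g \<in> Bij E" if g: "g \<in> carrier G" for g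
  proof -
    have "bij_betw (\<phi> g) E E"
    proof (rule bij_betw_byWitness[where f' = "\<phi> (inv\<^bsub>G\<^esub> g)"])
      show "\<forall>a\<in>E. \<phi> (inv\<^bsub>G\<^esub> g) (\<phi> g a) = a" "\<forall>a\<in>E. \<phi> g (\<phi> (inv\<^bsub>G\<^esub> g) a) = a"
        using R g by (metis inv_closed l_inv, metis inv_closed r_inv)
    qed (use R g in auto)
    then show ?thesis using R g by (simp add: Bij_def)
  qed
  have "\<phi> \<in> hom G (BijGroup E)"
  proof (rule homI)
    show "\<phi> g \<in> carrier (BijGroup E)" if "g \<in> carrier G" for g
      using B[OF that] by (simp add: BijGroup_def)
    show "\<phi> (g \<otimes>\<^bsub>G\<^esub> h) = \<phi> g \<otimes>\<^bsub>BijGroup E\<^esub> \<phi> h"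
      if "g \<in> carrier G" "h \<in> carrier G" for g h
    proof -
      have "\<phi> (g \<otimes>\<^bsub>G\<^esub> h) x = compose E (\<phi> g) (\<phi> h) x" for x
        using R that by (cases "x \<in> E") (auto simp: compose_def extensional_def)
      then show ?thesis using B that by (auto simp: BijGroup_def)
    qed
  qed
  then show "group_action G E \<phi>"
    by (simp add: group_action_def group_hom_def group_hom_axioms_def group_BijGroup assms)
qed

theorem minimal_flow_iso_set_set:
  fixes G :: "('g, 'b) monoid_scheme" and X :: "'x topology"
  assumes "minimal_flow G T X \<phi>"
  obtains Y :: "'g set set topology" and \<psi> and h
  where "minimal_flow G T Y \<psi>" "homeomorphic_map X Y h" "flow_map G X \<phi> Y \<psi> h"
proof -
  have fl: "flow G T X \<phi>"
    and dense: "\<And>x. x \<in> topspace X \<Longrightarrow> X closure_of (orbit G \<phi> x) = topspace X"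
    using assms by (auto simp: minimal_flow_def)
  have tg: "topological_group G T" and cpt: "compact_space X" and haus: "Hausdorff_space X"
    and act: "group_action G (topspace X) \<phi>"
    and cont: "continuous_map (prod_topology T X) X (\<lambda>(t, x). \<phi> t x)"
    using fl by (simp_all add: flow_def)
  obtain x0 where x0: "x0 \<in> topspace X" using fl unfolding flow_def by blast
  have grp: "group G" and tT: "topspace T = carrier G" using tg by (auto simp: topological_group_def)
  note A = act[unfolded group_action_alt[OF grp]]
  define e :: "'x \<Rightarrow> 'g set set" where
    "e y = {A. A \<subseteq> carrier G \<and> y \<in> X closure_of ((\<lambda>g. \<phi> g x0) ` A)}" for y
  have inj: "inj_on e (topspace X)"
  proof (rule inj_onI, rule ccontr)
    fix y z assume yz: "y \<in> topspace X" "z \<in> topspace X" "e y = e z" "y \<noteq> z"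
    obtain U V where UV: "openin X U" "openin X V" "y \<in> U" "z \<in> V" "disjnt U V"
      using haus yz unfolding Hausdorff_space_def by metis
    define A where "A = {g \<in> carrier G. \<phi> g x0 \<in> U}"
    have im: "(\<lambda>g. \<phi> g x0) ` A = U \<inter> orbit G \<phi> x0" by (auto simp: A_def orbit_def)
    have "y \<in> X closure_of ((\<lambda>g. \<phi> g x0) ` A)"
      using openin_Int_closure_of_subset[OF UV(1), of "orbit G \<phi> x0"] UV(3) yz(1) dense[OF x0]
      unfolding im by blast
    then have "A \<in> e y" by (auto simp: e_def A_def)
    then have "z \<in> X closure_of ((\<lambda>g. \<phi> g x0) ` A)" using yz(3) unfolding e_def by blast
    then obtain w where "w \<in> V" "w \<in> U"
      using UV unfolding im in_closure_of by blast
    then show False using UV(5) by (auto simp: disjnt_def)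
  qed
  define E where "E = e ` topspace X"
  define f where "f = inv_into (topspace X) e"
  define Y where "Y = pullback_topology E f X"
  have fe: "f (e x) = x" if "x \<in> topspace X" for x
    using inj that by (simp add: f_def)
  have fE: "f y \<in> topspace X" "e (f y) = y" if "y \<in> E" for y
    using that by (auto simp: E_def fe)
  have tY: "topspace Y = E"
    using fE by (auto simp: Y_def topspace_pullback_topology)
  have contf: "continuous_map Y X f"
    unfolding Y_def using continuous_map_pullback[OF continuous_map_id, of E f X] by simp
  have conte: "continuous_map X Y e"
    unfolding Y_def
  proof (rule continuous_map_pullback')
    show "continuous_map X X (f \<circ> e)"
      by (rule continuous_map_eq[OF continuous_map_id]) (auto simp: fe)
    show "topspace X \<subseteq> e -` E" by (auto simp: E_def)
  qed
  have hom: "homeomorphic_maps X Y e f"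
    unfolding homeomorphic_maps_def using contf conte by (auto simp: fe fE tY)
  then have hs: "X homeomorphic_space Y" by (auto simp: homeomorphic_space_def)
  define \<psi> where "\<psi> g = (\<lambda>y \<in> E. e (\<phi> g (f y)))" for g
  have eE: "e x \<in> E" if "x \<in> topspace X" for x using that by (auto simp: E_def)
  have fm: "flow_map G X \<phi> Y \<psi> e"
    unfolding flow_map_def using conte by (auto simp: \<psi>_def eE fe)
  have act': "group_action G (topspace Y) \<psi>"
    unfolding group_action_alt[OF grp] tY \<psi>_def
    using A by (auto simp: fE fe eE monoid.m_closed group.is_monoid[OF grp])
  have "continuous_map (prod_topology T Y) (prod_topology T X) (\<lambda>z. (fst z, f (snd z)))"
    by (intro continuous_map_pairedI continuous_map_fst
        continuous_map_compose[OF continuous_map_snd contf, unfolded comp_def])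
  then have "continuous_map (prod_topology T Y) Y (e \<circ> ((\<lambda>(t, x). \<phi> t x) \<circ> (\<lambda>z. (fst z, f (snd z)))))"
    by (intro continuous_map_compose[OF _ conte] continuous_map_compose[OF _ cont])
  then have cont': "continuous_map (prod_topology T Y) Y (\<lambda>(t, y). \<psi> t y)"
    by (rule continuous_map_eq) (auto simp: \<psi>_def tY)
  have flY: "flow G T Y \<psi>"
    unfolding flow_def
    using tg act' cont' x0 hs cpt haus homeomorphic_compact_space homeomorphic_Hausdorff_space
    by (auto simp: tY E_def)
  have "Y closure_of (orbit G \<psi> y) = topspace Y" if y: "y \<in> topspace Y" for y
  proof -
    have "orbit G \<psi> y = e ` orbit G \<phi> (f y)"
      using y by (auto simp: orbit_def \<psi>_def tY)
    moreover have "orbit G \<phi> (f y) \<subseteq> topspace X"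
      using A fE y by (auto simp: orbit_def tY)
    ultimately have "Y closure_of (orbit G \<psi> y) = e ` (X closure_of (orbit G \<phi> (f y)))"
      using homeomorphic_map_closure_of hom homeomorphic_map_maps by metis
    then show ?thesis using dense fE y by (simp add: tY E_def)
  qed
  then have "minimal_flow G T Y \<psi>" using flY by (simp add: minimal_flow_def)
  moreover have "homeomorphic_map X Y e" using hom homeomorphic_map_maps by blast
  ultimately show thesis using that fm by blast
qed

theorem universal_minimal_flow_surj:
  fixes G :: "('g, 'b) monoid_scheme" and M :: "'m topology" and X :: "'x topology"
  assumes "universal_minimal_flow G T M \<phi>" "minimal_flow G T X \<psi>"
  shows "\<exists>h. flow_map G M \<phi> X \<psi> h \<and> h ` topspace M = topspace X"
proof -
  obtain Y :: "'g set set topology" and \<rho> and e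
    where Y: "minimal_flow G T Y \<rho>" "homeomorphic_map X Y e" "flow_map G X \<psi> Y \<rho> e"
    using minimal_flow_iso_set_set[OF assms(2)] by metis
  obtain f where f: "homeomorphic_maps X Y e f" using Y(2) homeomorphic_map_maps by blast
  obtain h where h: "flow_map G M \<phi> Y \<rho> h" "h ` topspace M = topspace Y"
    using assms(1) Y(1) unfolding universal_minimal_flow_def by blast
  have f': "continuous_map Y X f" "\<And>x. x \<in> topspace X \<Longrightarrow> f (e x) = x"
    "\<And>y. y \<in> topspace Y \<Longrightarrow> e (f y) = y" "\<And>y. y \<in> topspace Y \<Longrightarrow> f y \<in> topspace X"
    "\<And>x. x \<in> topspace X \<Longrightarrow> e x \<in> topspace Y"
    using f by (auto simp: homeomorphic_maps_def continuous_map_def)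
  have grp: "group G" and act: "group_action G (topspace X) \<psi>"
    using assms(2) by (auto simp: minimal_flow_def flow_def topological_group_def)
  have eq: "f (\<rho> t y) = \<psi> t (f y)" if "t \<in> carrier G" "y \<in> topspace Y" for t y
    using Y(3) that f' act[unfolded group_action_alt[OF grp]] unfolding flow_map_def by metis
  have "flow_map G M \<phi> X \<psi> (f \<circ> h)"
    using h eq f'(1) unfolding flow_map_def by (auto intro: continuous_map_compose)
  moreover have "(f \<circ> h) ` topspace M = topspace X"
    unfolding image_comp[symmetric] h(2) using f' by force
  ultimately show ?thesis by blast
qed

end

theory Submission
  imports Defs
begin

text \<open>
  Precomposing the action on \<open>M\<close> with a topological automorphism \<open>a\<close> gives another minimal flow,
  onto which \<open>M\<close> surjects equivariantly. Hence if \<open>t\<close> acts trivially on \<open>M\<close>, so does \<open>a t\<close>. The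
  elements acting trivially form a closed subgroup, which therefore is all of \<open>G\<close>; since every
  orbit is dense, \<open>M\<close> is then a single point.
\<close>

definition acts_trivially :: "'x topology \<Rightarrow> ('g \<Rightarrow> 'x \<Rightarrow> 'x) \<Rightarrow> 'g \<Rightarrow> bool" where
  "acts_trivially X \<phi> t \<longleftrightarrow> (\<forall>x \<in> topspace X. \<phi> t x = x)"

lemma not_effective_at_iff: "\<not> effective_at X \<phi> t \<longleftrightarrow> acts_trivially X \<phi> t"
  by (simp add: effective_at_def acts_trivially_def)

lemma flow_group:
  assumes "flow G T X \<phi>"
  shows "group G"
  using assms by (simp add: flow_def topological_group_def)

lemma flow_topspace:
  assumes "flow G T X \<phi>"
  shows "topspace T = carrier G"
  using assms by (simp add: flow_def topological_group_def)

lemma flow_action: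
  assumes "flow G T X \<phi>"
  shows "\<And>g. g \<in> carrier G \<Longrightarrow> \<phi> g \<in> extensional (topspace X)"
    and "\<And>g x. g \<in> carrier G \<Longrightarrow> x \<in> topspace X \<Longrightarrow> \<phi> g x \<in> topspace X"
    and "\<And>x. x \<in> topspace X \<Longrightarrow> \<phi> \<one>\<^bsub>G\<^esub> x = x"
    and "\<And>g h x. g \<in> carrier G \<Longrightarrow> h \<in> carrier G \<Longrightarrow> x \<in> topspace X \<Longrightarrow>
           \<phi> (g \<otimes>\<^bsub>G\<^esub> h) x = \<phi> g (\<phi> h x)"
  using assms group_action_alt[OF flow_group[OF assms], of "topspace X" \<phi>]
  by (auto simp: flow_def)

text \<open>The action laws survive because \<open>a\<close> is a homomorphism. The new action map
  is the old one after \<open>a\<close> times the identity on \<open>T\<close> times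
  \<open>X\<close>, hence jointly continuous.\<close>

lemma flow_twist:
  assumes fl: "flow G T X \<phi>" and hom: "a \<in> hom G G" and cont: "continuous_map T T a"
  shows "flow G T X (\<phi> \<circ> a)"
proof -
  have grp: "group G" using fl by (rule flow_group)
  note A = flow_action[OF fl]
  have a: "a g \<in> carrier G" if "g \<in> carrier G" for g
    using hom that by (rule hom_in_carrier)
  have "group_action G (topspace X) (\<phi> \<circ> a)"
    unfolding group_action_alt[OF grp]
    using A a hom by (auto simp: hom_mult[OF hom] hom_one[OF hom grp grp])
  moreover have "continuous_map (prod_topology T X) X (\<lambda>(t, x). (\<phi> \<circ> a) t x)"
  proof -
    have c: "continuous_map (prod_topology T X) (prod_topology T X) (\<lambda>z. (a (fst z), snd z))"
      by (intro continuous_map_pairedI continuous_map_snd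
          continuous_map_compose[OF continuous_map_fst cont, unfolded comp_def])
    have "continuous_map (prod_topology T X) X ((\<lambda>(t, x). \<phi> t x) \<circ> (\<lambda>z. (a (fst z), snd z)))"
      using fl by (intro continuous_map_compose[OF c]) (simp add: flow_def)
    then show ?thesis by (rule continuous_map_eq) auto
  qed
  ultimately show ?thesis using fl by (simp add: flow_def)
qed

text \<open>An automorphism maps the group onto itself, so twisting only reparametrizes each orbit.
  As sets the orbits are unchanged and remain dense.\<close>

lemma minimal_flow_twist:
  assumes "minimal_flow G T X \<phi>" and a: "a \<in> topological_auto G T"
  shows "minimal_flow G T X (\<phi> \<circ> a)"
proof -
  have hom: "a \<in> hom G G" and cont: "continuous_map T T a" and im: "a ` carrier G = carrier G"
    using a by (auto simp: topological_auto_def auto_def Bij_def bij_betw_def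
        homeomorphic_imp_continuous_map)
  have "orbit G (\<phi> \<circ> a) x = orbit G \<phi> x" for x
  proof -
    have "orbit G (\<phi> \<circ> a) x = (\<lambda>g. \<phi> g x) ` (a ` carrier G)" by (auto simp: orbit_def)
    also have "\<dots> = orbit G \<phi> x" unfolding im by (auto simp: orbit_def)
    finally show ?thesis .
  qed
  moreover have "flow G T X (\<phi> \<circ> a)"
    using assms(1) by (intro flow_twist[OF _ hom cont]) (simp add: minimal_flow_def)
  ultimately show ?thesis using assms(1) by (simp add: minimal_flow_def)
qed

text \<open>Triviality descends to quotients: for \<open>y = h x\<close>, equivariance gives
  \<open>\<psi> t y = h (\<phi> t x) = h x = y\<close>.\<close>

lemma acts_trivially_flow_map:
  assumes "flow_map G X \<phi> Y \<psi> h" "h ` topspace X = topspace Y"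
    and "t \<in> carrier G" "acts_trivially X \<phi> t"
  shows "acts_trivially Y \<psi> t"
  unfolding acts_trivially_def
proof
  fix y assume "y \<in> topspace Y"
  then obtain x where "x \<in> topspace X" "y = h x" using assms(2) by blast
  then show "\<psi> t y = y"
    using assms(1,3,4) by (simp add: flow_map_def acts_trivially_def) metis
qed

text \<open>Universality is applied to \<open>M\<close> itself with the twisted action as target.
  Trivial action of \<open>t\<close> on the source descends to the target, where \<open>t\<close>
  acts as \<open>\<phi> (a t)\<close>.\<close>

lemma acts_trivially_auto:
  assumes "universal_minimal_flow G T M \<phi>" and "a \<in> topological_auto G T"
    and "t \<in> carrier G" "acts_trivially M \<phi> t"
  shows "acts_trivially M \<phi> (a t)"
proof -
  have "minimal_flow G T M (\<phi> \<circ> a)"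
    using assms(1) by (intro minimal_flow_twist[OF _ assms(2)]) (simp add: universal_minimal_flow_def)
  then obtain h where "flow_map G M \<phi> M (\<phi> \<circ> a) h" "h ` topspace M = topspace M"
    using universal_minimal_flow_surj[OF assms(1)] by blast
  then have "acts_trivially M (\<phi> \<circ> a) t" using assms(3,4) by (intro acts_trivially_flow_map[of G M \<phi> M "\<phi> \<circ> a"])
  then show ?thesis by (simp add: acts_trivially_def)
qed

lemma subgroup_acts_trivially:
  assumes "flow G T X \<phi>"
  shows "subgroup {g \<in> carrier G. acts_trivially X \<phi> g} G"
proof -
  interpret group G using assms by (rule flow_group)
  note A = flow_action[OF assms]
  show ?thesis
  proof (rule subgroupI)
    show "{g \<in> carrier G. acts_trivially X \<phi> g} \<noteq> {}"
      using A by (auto simp: acts_trivially_def)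
  next
    fix g assume g: "g \<in> {g \<in> carrier G. acts_trivially X \<phi> g}"
    have "\<phi> (inv\<^bsub>G\<^esub> g) x = x" if x: "x \<in> topspace X" for x
    proof -
      have "\<phi> (inv\<^bsub>G\<^esub> g) x = \<phi> (inv\<^bsub>G\<^esub> g) (\<phi> g x)"
        using g x by (simp add: acts_trivially_def)
      also have "\<dots> = \<phi> (inv\<^bsub>G\<^esub> g \<otimes>\<^bsub>G\<^esub> g) x"
        using A(4)[of "inv\<^bsub>G\<^esub> g" g x] g x by simp
      finally show ?thesis using A(3) g x by simp
    qed
    then show "inv\<^bsub>G\<^esub> g \<in> {g \<in> carrier G. acts_trivially X \<phi> g}"
      using g by (simp add: acts_trivially_def)
  qed (use A in \<open>auto simp: acts_trivially_def\<close>)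
qed

text \<open>For each \<open>x\<close> the stabilizer is the preimage of the closed point
  \<open>{x}\<close> under the continuous orbit map of \<open>x\<close>. The kernel of the action is
  the intersection of all stabilizers.\<close>

lemma closedin_acts_trivially:
  assumes "flow G T X \<phi>"
  shows "closedin T {g \<in> carrier G. acts_trivially X \<phi> g}"
proof -
  have "closedin T {g \<in> topspace T. \<phi> g x = x}" if x: "x \<in> topspace X" for x
  proof -
    have "continuous_map T (prod_topology T X) (\<lambda>g. (g, x))"
      using x by (simp add: continuous_map_paired)
    then have "continuous_map T X ((\<lambda>(g, x). \<phi> g x) \<circ> (\<lambda>g. (g, x)))"
      using assms by (intro continuous_map_compose[of T "prod_topology T X"]) (auto simp: flow_def)
    then have "continuous_map T X (\<lambda>g. \<phi> g x)" by (simp add: comp_def)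
    moreover have "closedin X {x}"
      using assms x by (simp add: flow_def closedin_Hausdorff_singleton)
    ultimately show ?thesis
      using closedin_continuous_map_preimage[of T X "\<lambda>g. \<phi> g x" "{x}"] by simp
  qed
  \<comment> \<open>Nonemptiness of \<open>topspace X\<close>, which is part of \<open>flow\<close>,
    matters here: an intersection over no points would be \<open>UNIV\<close>.\<close>
  moreover have "{g \<in> carrier G. acts_trivially X \<phi> g} =
      (\<Inter>x \<in> topspace X. {g \<in> topspace T. \<phi> g x = x})"
    using assms flow_topspace[OF assms] by (auto simp: acts_trivially_def flow_def)
  ultimately show ?thesis using assms by (auto simp: flow_def intro!: closedin_INT)
qed

text \<open>Each orbit is then a single point, which is closed because the space is Hausdorff and
  dense because the flow is minimal.\<close>

lemma minimal_flow_acts_trivially_singleton: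
  assumes mf: "minimal_flow G T X \<phi>"
    and triv: "\<And>g. g \<in> carrier G \<Longrightarrow> acts_trivially X \<phi> g"
  obtains p where "topspace X = {p}"
proof -
  have fl: "flow G T X \<phi>" using mf by (simp add: minimal_flow_def)
  then obtain p where p: "p \<in> topspace X" unfolding flow_def by blast
  \<comment> \<open>The unit witnesses that the orbit of \<open>p\<close> is nonempty, so that it
    equals \<open>{p}\<close>.\<close>
  have "\<one>\<^bsub>G\<^esub> \<in> carrier G"
    using flow_group[OF fl] by (simp add: group.is_monoid monoid.one_closed)
  moreover have "\<phi> g p = p" if "g \<in> carrier G" for g
    using triv[OF that] p by (simp add: acts_trivially_def)
  ultimately have "orbit G \<phi> p = {p}" by (force simp: orbit_def)
  moreover have "closedin X {p}"
    using fl p by (simp add: flow_def closedin_Hausdorff_singleton)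
  ultimately have "topspace X = {p}"
    using mf p by (metis closure_of_closedin minimal_flow_def)
  then show thesis by (rule that)
qed

text \<open>A surjection from \<open>Y\<close> onto \<open>M\<close>, followed by those that
  \<open>M\<close> has onto minimal flows, makes \<open>Y\<close> universal as well. This transfers
  universality to a copy of \<open>M\<close> on another type.\<close>

lemma universal_minimal_flow_flow_map:
  assumes "universal_minimal_flow G T M \<phi>" "minimal_flow G T Y \<psi>"
    and k: "flow_map G Y \<psi> M \<phi> k" "k ` topspace Y = topspace M"
  shows "universal_minimal_flow G T Y \<psi>"
  unfolding universal_minimal_flow_def
proof (intro conjI allI impI)
  fix Z :: "'a set set topology" and \<rho>
  assume "minimal_flow G T Z \<rho>"
  then obtain h where h: "flow_map G M \<phi> Z \<rho> h" "h ` topspace M = topspace Z"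
    using assms(1) unfolding universal_minimal_flow_def by blast
  have "k y \<in> topspace M" if "y \<in> topspace Y" for y
    using k that by blast
  then have "flow_map G Y \<psi> Z \<rho> (h \<circ> k)"
    using h(1) k(1) unfolding flow_map_def by (auto intro: continuous_map_compose)
  moreover have "(h \<circ> k) ` topspace Y = topspace Z"
    using h k by (metis image_comp)
  ultimately show "\<exists>h. flow_map G Y \<psi> Z \<rho> h \<and> h ` topspace Y = topspace Z" by blast
qed fact

text \<open>The definition of \<open>extremely_amenable\<close> asks for a one-point flow inside
  \<open>'g set set\<close>, while \<open>M\<close> may live on any type. So \<open>M\<close> is
  first replaced by an isomorphic copy \<open>Y\<close> there.\<close>

lemma extremely_amenable_singleton:
  assumes umf: "universal_minimal_flow G T M \<phi>" and p: "topspace M = {p}"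
  shows "extremely_amenable G T"
proof -
  have mf: "minimal_flow G T M \<phi>" using umf by (simp add: universal_minimal_flow_def)
  then have fl: "flow G T M \<phi>" by (simp add: minimal_flow_def)
  obtain Y :: "'a set set topology" and \<psi> h
    where Y: "minimal_flow G T Y \<psi>" "homeomorphic_map M Y h"
    using minimal_flow_iso_set_set[OF mf] by metis
  have tY: "topspace Y = {h p}"
    using homeomorphic_imp_surjective_map[OF Y(2)] p by simp
  have "\<phi> g p = p" if "g \<in> carrier G" for g
    using flow_action(2)[OF fl that] p by simp
  \<comment> \<open>Since \<open>M\<close> is the fixed point \<open>p\<close>, the constant map is
    equivariant and onto and can serve in place of the inverse of \<open>h\<close>.\<close>
  then have "flow_map G Y \<psi> M \<phi> (\<lambda>_. p)"
    using p by (simp add: flow_map_def)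
  then have "universal_minimal_flow G T Y \<psi>"
    using universal_minimal_flow_flow_map[OF umf Y(1)] p tY by simp
  then show ?thesis using tY unfolding extremely_amenable_def by blast
qed

theorem theorem2p1:
  fixes G :: "('g, 'b) monoid_scheme" and T :: "'g topology"
    and M :: "'m topology" and \<phi> :: "'g \<Rightarrow> 'm \<Rightarrow> 'm"
  assumes "topological_group G T"
    and "\<not> extremely_amenable G T"
    and "universal_minimal_flow G T M \<phi>"
    and "t \<in> carrier G"
    and "T closure_of (generate G {a t | a. a \<in> topological_auto G T}) = topspace T"
  shows "effective_at M \<phi> t"
proof (rule ccontr)
  assume "\<not> effective_at M \<phi> t"
  then have triv: "acts_trivially M \<phi> t" by (simp add: not_effective_at_iff)
  have mf: "minimal_flow G T M \<phi>" using assms(3) by (simp add: universal_minimal_flow_def)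
  then have fl: "flow G T M \<phi>" by (simp add: minimal_flow_def)
  \<comment> \<open>\<open>N\<close> is the kernel of the action, a closed subgroup. It contains the
    generators, then the subgroup they generate, then its closure, which is all of the
    group.\<close>
  define N where "N = {g \<in> carrier G. acts_trivially M \<phi> g}"
  have "a t \<in> carrier G" if "a \<in> topological_auto G T" for a
    using that hom_in_carrier[OF _ assms(4), of a G] by (simp add: topological_auto_def auto_def)
  then have "{a t | a. a \<in> topological_auto G T} \<subseteq> N"
    using acts_trivially_auto[OF assms(3) _ assms(4) triv] by (auto simp: N_def)
  then have "generate G {a t | a. a \<in> topological_auto G T} \<subseteq> N"
    using subgroup_acts_trivially[OF fl] unfolding N_def
    by (rule group.generate_subgroup_incl[OF flow_group[OF fl]])
  then have "topspace T \<subseteq> N"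
    unfolding assms(5)[symmetric] N_def
    by (rule closure_of_minimal[OF _ closedin_acts_trivially[OF fl]])
  then have "acts_trivially M \<phi> g" if "g \<in> carrier G" for g
    using that flow_topspace[OF fl] by (auto simp: N_def)
  then obtain p where "topspace M = {p}"
    by (rule minimal_flow_acts_trivially_singleton[OF mf])
  then have "extremely_amenable G T" by (rule extremely_amenable_singleton[OF assms(3)])
  then show False using assms(2) by contradiction
qed

end
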